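(* Let $H$ be a Heyting algebra, $F$ a finite Heyting algebra, and $\tau:H\to F$ a function satisfying $\tau(\top_H)=\top_F$ and $\tau(a\sqcap_H b)=\tau(a)\sqcap_F\tau(b)$ for all $a,b\in H$. Then the Artin gluing $H\ltimes_\tau F$ is a Heyting algebra. Moreover, if $H$, $F$ and $\tau$ are definable, then $H\ltimes_\tau F$ is a definable Heyting algebra.
   Context: Fix an o-minimal structure $R$ expanding a real-closed field. "Definable" means definable in $R$ with parameters; a definable Heyting algebra is one whose underlying set is a definable subset of some $R^n$ and whose order relation (equivalently, operations) is definable. For $H,F,\tau$ as in the claim, the Artin gluing of $H$ and $F$ along $\tau$ is the set $H\ltimes_\tau F=\{(h,f)\in H\times F : f\sqsubseteq_F\tau(h)\}$ equipped with pointwise operations $\sqcap,\sqcup$ and the operation $$(h_1,f_1)\Rightarrow(h_2,f_2)=\bigl(h_1\Rightarrow_H h_2,\ (f_1\Rightarrow_F f_2)\sqcap_F\tau(h_1\Rightarrow_H h_2)\bigr).$$ *)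

theory Defs
  imports Main "HOL-Library.FuncSet"
begin

section \<open>Heyting algebras and Artin gluing\<close>

record 'a heyting =
  carrier :: "'a set"
  meet :: "'a \<Rightarrow> 'a \<Rightarrow> 'a" (infixl \<open>\<sqinter>\<index>\<close> 70)
  join :: "'a \<Rightarrow> 'a \<Rightarrow> 'a" (infixl \<open>\<squnion>\<index>\<close> 65)
  himp :: "'a \<Rightarrow> 'a \<Rightarrow> 'a" (infixr \<open>\<leadsto>\<index>\<close> 60)
  hbot :: 'a (\<open>\<bottom>\<index>\<close>)
  htop :: 'a (\<open>\<top>\<index>\<close>)

definition le :: "('a, 'z) heyting_scheme \<Rightarrow> 'a \<Rightarrow> 'a \<Rightarrow> bool" (infix \<open>\<sqsubseteq>\<index>\<close> 50)
  where "x \<sqsubseteq>\<^bsub>A\<^esub> y \<longleftrightarrow> x \<sqinter>\<^bsub>A\<^esub> y = x"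

locale heyting_algebra =
  fixes A :: "('a, 'z) heyting_scheme" (structure)
  assumes meet_closed: "\<lbrakk>x \<in> carrier A; y \<in> carrier A\<rbrakk> \<Longrightarrow> x \<sqinter> y \<in> carrier A"
    and join_closed: "\<lbrakk>x \<in> carrier A; y \<in> carrier A\<rbrakk> \<Longrightarrow> x \<squnion> y \<in> carrier A"
    and himp_closed: "\<lbrakk>x \<in> carrier A; y \<in> carrier A\<rbrakk> \<Longrightarrow> x \<leadsto> y \<in> carrier A"
    and hbot_closed: "\<bottom> \<in> carrier A"
    and htop_closed: "\<top> \<in> carrier A"
    and meet_commute: "\<lbrakk>x \<in> carrier A; y \<in> carrier A\<rbrakk> \<Longrightarrow> x \<sqinter> y = y \<sqinter> x"
    and join_commute: "\<lbrakk>x \<in> carrier A; y \<in> carrier A\<rbrakk> \<Longrightarrow> x \<squnion> y = y \<squnion> x"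
    and meet_assoc: "\<lbrakk>x \<in> carrier A; y \<in> carrier A; z \<in> carrier A\<rbrakk> \<Longrightarrow> (x \<sqinter> y) \<sqinter> z = x \<sqinter> (y \<sqinter> z)"
    and join_assoc: "\<lbrakk>x \<in> carrier A; y \<in> carrier A; z \<in> carrier A\<rbrakk> \<Longrightarrow> (x \<squnion> y) \<squnion> z = x \<squnion> (y \<squnion> z)"
    and meet_join_absorb: "\<lbrakk>x \<in> carrier A; y \<in> carrier A\<rbrakk> \<Longrightarrow> x \<sqinter> (x \<squnion> y) = x"
    and join_meet_absorb: "\<lbrakk>x \<in> carrier A; y \<in> carrier A\<rbrakk> \<Longrightarrow> x \<squnion> (x \<sqinter> y) = x"
    and hbot_least: "x \<in> carrier A \<Longrightarrow> \<bottom> \<sqsubseteq> x"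
    and htop_greatest: "x \<in> carrier A \<Longrightarrow> x \<sqsubseteq> \<top>"
    and residuation: "\<lbrakk>x \<in> carrier A; y \<in> carrier A; z \<in> carrier A\<rbrakk>
      \<Longrightarrow> z \<sqinter> x \<sqsubseteq> y \<longleftrightarrow> z \<sqsubseteq> x \<leadsto> y"

definition artin_gluing :: "'a heyting \<Rightarrow> 'b heyting \<Rightarrow> ('a \<Rightarrow> 'b) \<Rightarrow> ('a \<times> 'b) heyting"
  where "artin_gluing H F \<tau> =
    \<lparr> carrier = {(h, f). h \<in> carrier H \<and> f \<in> carrier F \<and> f \<sqsubseteq>\<^bsub>F\<^esub> \<tau> h},
      meet = (\<lambda>(h1, f1) (h2, f2). (h1 \<sqinter>\<^bsub>H\<^esub> h2, f1 \<sqinter>\<^bsub>F\<^esub> f2)),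
      join = (\<lambda>(h1, f1) (h2, f2). (h1 \<squnion>\<^bsub>H\<^esub> h2, f1 \<squnion>\<^bsub>F\<^esub> f2)),
      himp = (\<lambda>(h1, f1) (h2, f2).
        (h1 \<leadsto>\<^bsub>H\<^esub> h2, (f1 \<leadsto>\<^bsub>F\<^esub> f2) \<sqinter>\<^bsub>F\<^esub> \<tau> (h1 \<leadsto>\<^bsub>H\<^esub> h2))),
      hbot = (\<bottom>\<^bsub>H\<^esub>, \<bottom>\<^bsub>F\<^esub>),
      htop = (\<top>\<^bsub>H\<^esub>, \<top>\<^bsub>F\<^esub>) \<rparr>"

locale gluing_data = H: heyting_algebra H + F: heyting_algebra F
  for H :: "'a heyting" and F :: "'b heyting" +
  fixes \<tau> :: "'a \<Rightarrow> 'b"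
  assumes finite_F: "finite (carrier F)"
    and maps_to: "\<tau> \<in> carrier H \<rightarrow> carrier F"
    and top_preserving: "\<tau> \<top>\<^bsub>H\<^esub> = \<top>\<^bsub>F\<^esub>"
    and meet_preserving:
      "\<lbrakk>a \<in> carrier H; b \<in> carrier H\<rbrakk> \<Longrightarrow> \<tau> (a \<sqinter>\<^bsub>H\<^esub> b) = \<tau> a \<sqinter>\<^bsub>F\<^esub> \<tau> b"

section \<open>O-minimal expansions of real closed fields\<close>

class real_closed_field = linordered_field +
  assumes nonneg_has_sqrt: "0 \<le> x \<Longrightarrow> \<exists>y. y * y = x"
    and odd_degree_has_root:
      "\<lbrakk>odd n; c n \<noteq> 0\<rbrakk> \<Longrightarrow> \<exists>x. (\<Sum>k\<le>n. c k * x ^ k) = 0"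

text \<open>
  First-order formulas over the language of ordered rings, extended by function
  symbols of type \<open>'f\<close> and relation symbols of type \<open>'p\<close>.
  Variables are de Bruijn indices.
\<close>

datatype 'f fo_term =
    Var nat
  | Zero
  | One
  | Plus "'f fo_term" "'f fo_term"
  | Minus "'f fo_term"
  | Times "'f fo_term" "'f fo_term"
  | App 'f "'f fo_term list"

datatype ('f, 'p) formula =
    Equal "'f fo_term" "'f fo_term"
  | Less "'f fo_term" "'f fo_term"
  | Rel 'p "'f fo_term list"
  | Neg "('f, 'p) formula"
  | Conj "('f, 'p) formula" "('f, 'p) formula"
  | Exists "('f, 'p) formula"

text \<open>
  An expansion of the ordered field \<open>'r\<close>. A symbol with arity \<open>None\<close> does not belong to
  the language, so that languages with no additional symbols are covered; the
  interpretation of a symbol matters only on argument lists of the right length.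
\<close>

record ('f, 'p, 'r) expansion =
  fun_arity :: "'f \<Rightarrow> nat option"
  fun_interp :: "'f \<Rightarrow> 'r list \<Rightarrow> 'r"
  rel_arity :: "'p \<Rightarrow> nat option"
  rel_interp :: "'p \<Rightarrow> 'r list \<Rightarrow> bool"

fun wf_term :: "('f, 'p, 'r) expansion \<Rightarrow> 'f fo_term \<Rightarrow> bool" where
  "wf_term M (Var i) \<longleftrightarrow> True"
| "wf_term M Zero \<longleftrightarrow> True"
| "wf_term M One \<longleftrightarrow> True"
| "wf_term M (Plus s t) \<longleftrightarrow> wf_term M s \<and> wf_term M t"
| "wf_term M (Minus t) \<longleftrightarrow> wf_term M t"
| "wf_term M (Times s t) \<longleftrightarrow> wf_term M s \<and> wf_term M t"
| "wf_term M (App f ts) \<longleftrightarrow> fun_arity M f = Some (length ts) \<and> (\<forall>t\<in>set ts. wf_term M t)"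

fun wf_formula :: "('f, 'p, 'r) expansion \<Rightarrow> ('f, 'p) formula \<Rightarrow> bool" where
  "wf_formula M (Equal s t) \<longleftrightarrow> wf_term M s \<and> wf_term M t"
| "wf_formula M (Less s t) \<longleftrightarrow> wf_term M s \<and> wf_term M t"
| "wf_formula M (Rel p ts) \<longleftrightarrow> rel_arity M p = Some (length ts) \<and> (\<forall>t\<in>set ts. wf_term M t)"
| "wf_formula M (Neg \<phi>) \<longleftrightarrow> wf_formula M \<phi>"
| "wf_formula M (Conj \<phi> \<psi>) \<longleftrightarrow> wf_formula M \<phi> \<and> wf_formula M \<psi>"
| "wf_formula M (Exists \<phi>) \<longleftrightarrow> wf_formula M \<phi>"

fun eval_term :: "('f, 'p, 'r::linordered_field) expansion \<Rightarrow> (nat \<Rightarrow> 'r) \<Rightarrow> 'f fo_term \<Rightarrow> 'r" where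
  "eval_term M e (Var i) = e i"
| "eval_term M e Zero = 0"
| "eval_term M e One = 1"
| "eval_term M e (Plus s t) = eval_term M e s + eval_term M e t"
| "eval_term M e (Minus t) = - eval_term M e t"
| "eval_term M e (Times s t) = eval_term M e s * eval_term M e t"
| "eval_term M e (App f ts) = fun_interp M f (map (eval_term M e) ts)"

fun sat :: "('f, 'p, 'r::linordered_field) expansion \<Rightarrow> (nat \<Rightarrow> 'r) \<Rightarrow> ('f, 'p) formula \<Rightarrow> bool" where
  "sat M e (Equal s t) \<longleftrightarrow> eval_term M e s = eval_term M e t"
| "sat M e (Less s t) \<longleftrightarrow> eval_term M e s < eval_term M e t"
| "sat M e (Rel p ts) \<longleftrightarrow> rel_interp M p (map (eval_term M e) ts)"
| "sat M e (Neg \<phi>) \<longleftrightarrow> \<not> sat M e \<phi>"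
| "sat M e (Conj \<phi> \<psi>) \<longleftrightarrow> sat M e \<phi> \<and> sat M e \<psi>"
| "sat M e (Exists \<phi>) \<longleftrightarrow> (\<exists>x. sat M (case_nat x e) \<phi>)"

text \<open>
  Points of \<open>R\<^sup>n\<close> are lists of length \<open>n\<close>, and \<open>R\<^sup>m \<times> R\<^sup>n\<close> is identified with
  \<open>R\<^sup>m\<^sup>+\<^sup>n\<close> by concatenation. The parameters of a definable set are the values
  \<open>e i\<close> of the free variables \<open>i \<ge> n\<close>, of which a formula contains only finitely many.
\<close>

definition definable :: "('f, 'p, 'r::linordered_field) expansion \<Rightarrow> nat \<Rightarrow> 'r list set \<Rightarrow> bool"
  where "definable M n X \<longleftrightarrow> (\<exists>\<phi> e. wf_formula M \<phi> \<and>
    X = {xs. length xs = n \<and> sat M (\<lambda>i. if i < n then xs ! i else e i) \<phi>})"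

definition points_and_open_intervals :: "'r::linorder set set"
  where "points_and_open_intervals =
    {{a} | a. True} \<union> {{a<..<b} | a b. True} \<union> {{..<b} | b. True} \<union> {{a<..} | a. True} \<union> {UNIV}"

definition o_minimal :: "('f, 'p, 'r::linordered_field) expansion \<Rightarrow> bool"
  where "o_minimal M \<longleftrightarrow> (\<forall>X. definable M 1 ((\<lambda>x. [x]) ` X) \<longrightarrow>
    (\<exists>C. finite C \<and> C \<subseteq> points_and_open_intervals \<and> X = \<Union>C))"

definition definable_map ::
  "('f, 'p, 'r::linordered_field) expansion \<Rightarrow> nat \<Rightarrow> nat \<Rightarrow> 'r list set \<Rightarrow> ('r list \<Rightarrow> 'r list) \<Rightarrow> bool"
  where "definable_map M n m X g \<longleftrightarrow> definable M (n + m) {x @ g x | x. x \<in> X}"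

definition definable_heyting ::
  "('f, 'p, 'r::linordered_field) expansion \<Rightarrow> nat \<Rightarrow> 'r list heyting \<Rightarrow> bool"
  where "definable_heyting M n A \<longleftrightarrow> heyting_algebra A \<and> definable M n (carrier A) \<and>
    definable M (n + n) {x @ y | x y. x \<in> carrier A \<and> y \<in> carrier A \<and> x \<sqsubseteq>\<^bsub>A\<^esub> y}"

text \<open>
  Transport of a Heyting structure on a subset of \<open>R\<^sup>n \<times> R\<^sup>m\<close> to one on a subset of
  \<open>R\<^sup>n\<^sup>+\<^sup>m\<close>, along the bijection given by concatenation.
\<close>

definition concat_heyting :: "nat \<Rightarrow> ('r list \<times> 'r list) heyting \<Rightarrow> 'r list heyting"
  where "concat_heyting n A =
    (let join_pair = (\<lambda>(x, y). x @ y); split = (\<lambda>u. (take n u, drop n u)) in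
    \<lparr> carrier = join_pair ` carrier A,
      meet = (\<lambda>u v. join_pair (split u \<sqinter>\<^bsub>A\<^esub> split v)),
      join = (\<lambda>u v. join_pair (split u \<squnion>\<^bsub>A\<^esub> split v)),
      himp = (\<lambda>u v. join_pair (split u \<leadsto>\<^bsub>A\<^esub> split v)),
      hbot = join_pair \<bottom>\<^bsub>A\<^esub>,
      htop = join_pair \<top>\<^bsub>A\<^esub> \<rparr>)"

end

theory Submission
  imports Defs
begin

text \<open>
  Since \<open>\<tau>\<close> preserves meets it is monotone. Hence \<open>f \<sqsubseteq> \<tau> h\<close> and \<open>h \<sqsubseteq> h1 \<leadsto> h2\<close> force
  \<open>f \<sqsubseteq> \<tau> (h1 \<leadsto> h2)\<close>, so that the correction term in the implication of the gluing does
  not disturb residuation. The carrier of the gluing is definable because it consists of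
  the pairs \<open>(h, f)\<close> for which some \<open>y\<close> lies above \<open>f\<close> and has \<open>(h, y)\<close> on the graph of \<open>\<tau>\<close>; its
  order is the restriction of the product order.
\<close>

section \<open>Artin gluing\<close>

context heyting_algebra
begin

text \<open>One absorption law rewrites \<open>x\<close> as
  \<open>x \<squnion> (x \<sqinter> \<bottom>)\<close>, and the other evaluates the meet of
  \<open>x\<close> with that join.\<close>

lemma meet_idem: "x \<in> carrier A \<Longrightarrow> x \<sqinter> x = x"
  by (metis hbot_closed join_meet_absorb meet_closed meet_join_absorb)

lemma le_trans:
  "\<lbrakk>x \<sqsubseteq> y; y \<sqsubseteq> z; x \<in> carrier A; y \<in> carrier A; z \<in> carrier A\<rbrakk> \<Longrightarrow> x \<sqsubseteq> z"
  unfolding le_def by (metis meet_assoc)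

lemma le_meet_iff:
  assumes "x \<in> carrier A" "y \<in> carrier A" "z \<in> carrier A"
  shows "x \<sqsubseteq> y \<sqinter> z \<longleftrightarrow> x \<sqsubseteq> y \<and> x \<sqsubseteq> z"
  using assms unfolding le_def by (metis meet_assoc meet_commute meet_idem meet_closed)

lemma meet_le2: "\<lbrakk>x \<in> carrier A; y \<in> carrier A\<rbrakk> \<Longrightarrow> x \<sqinter> y \<sqsubseteq> y"
  unfolding le_def by (simp add: meet_assoc meet_idem)

lemma meet_mono:
  assumes "x \<sqsubseteq> y" "x' \<sqsubseteq> y'"
    and "x \<in> carrier A" "y \<in> carrier A" "x' \<in> carrier A" "y' \<in> carrier A"
  shows "x \<sqinter> x' \<sqsubseteq> y \<sqinter> y'"
  using assms unfolding le_def by (metis meet_assoc meet_commute meet_closed)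

lemma le_join1: "\<lbrakk>x \<in> carrier A; y \<in> carrier A\<rbrakk> \<Longrightarrow> x \<sqsubseteq> x \<squnion> y"
  unfolding le_def by (rule meet_join_absorb)

lemma le_join2: "\<lbrakk>x \<in> carrier A; y \<in> carrier A\<rbrakk> \<Longrightarrow> y \<sqsubseteq> x \<squnion> y"
  by (metis le_join1 join_commute)

text \<open>The order is defined through meets; absorption turns it into an equation between joins,
  after which \<open>join_least\<close> is a matter of associativity.\<close>

lemma le_iff_join_eq:
  "\<lbrakk>x \<in> carrier A; y \<in> carrier A\<rbrakk> \<Longrightarrow> x \<sqsubseteq> y \<longleftrightarrow> x \<squnion> y = y"
  unfolding le_def by (metis meet_join_absorb join_meet_absorb join_commute meet_commute)

lemma join_least:
  "\<lbrakk>x \<sqsubseteq> z; y \<sqsubseteq> z; x \<in> carrier A; y \<in> carrier A; z \<in> carrier A\<rbrakk> \<Longrightarrow> x \<squnion> y \<sqsubseteq> z"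
  by (metis le_iff_join_eq join_assoc join_closed)

end

section \<open>The gluing as a Heyting algebra\<close>

context gluing_data
begin

lemma tau_closed: "a \<in> carrier H \<Longrightarrow> \<tau> a \<in> carrier F"
  using maps_to by auto

lemma tau_mono:
  "\<lbrakk>a \<sqsubseteq>\<^bsub>H\<^esub> b; a \<in> carrier H; b \<in> carrier H\<rbrakk> \<Longrightarrow> \<tau> a \<sqsubseteq>\<^bsub>F\<^esub> \<tau> b"
  unfolding le_def by (metis meet_preserving)

text \<open>Although \<open>\<tau>\<close> need not preserve joins, monotonicity puts
  \<open>\<tau> h1\<close> and \<open>\<tau> h2\<close> below its value at the join. This is closure
  of the gluing under joins.\<close>

lemma gluing_join_below:
  assumes "h1 \<in> carrier H" "h2 \<in> carrier H" "f1 \<in> carrier F" "f2 \<in> carrier F"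
    and "f1 \<sqsubseteq>\<^bsub>F\<^esub> \<tau> h1" "f2 \<sqsubseteq>\<^bsub>F\<^esub> \<tau> h2"
  shows "f1 \<squnion>\<^bsub>F\<^esub> f2 \<sqsubseteq>\<^bsub>F\<^esub> \<tau> (h1 \<squnion>\<^bsub>H\<^esub> h2)"
proof (rule F.join_least)
  show "f1 \<sqsubseteq>\<^bsub>F\<^esub> \<tau> (h1 \<squnion>\<^bsub>H\<^esub> h2)"
    using assms by (meson F.le_trans H.le_join1 H.join_closed tau_mono tau_closed)
  show "f2 \<sqsubseteq>\<^bsub>F\<^esub> \<tau> (h1 \<squnion>\<^bsub>H\<^esub> h2)"
    using assms by (meson F.le_trans H.le_join2 H.join_closed tau_mono tau_closed)
qed (use assms in \<open>auto intro: H.join_closed tau_closed\<close>)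

text \<open>By \<open>le_meet_iff\<close> the right side has three conjuncts. Two match the left
  side by residuation in the factors; the third follows from the first because \<open>f\<close> lies
  below \<open>\<tau> h\<close>.\<close>

lemma gluing_residuation:
  assumes "h \<in> carrier H" "h1 \<in> carrier H" "h2 \<in> carrier H"
    and "f \<in> carrier F" "f1 \<in> carrier F" "f2 \<in> carrier F"
    and "f \<sqsubseteq>\<^bsub>F\<^esub> \<tau> h"
  shows "h \<sqinter>\<^bsub>H\<^esub> h1 \<sqsubseteq>\<^bsub>H\<^esub> h2 \<and> f \<sqinter>\<^bsub>F\<^esub> f1 \<sqsubseteq>\<^bsub>F\<^esub> f2 \<longleftrightarrow>
    h \<sqsubseteq>\<^bsub>H\<^esub> h1 \<leadsto>\<^bsub>H\<^esub> h2 \<and> f \<sqsubseteq>\<^bsub>F\<^esub> (f1 \<leadsto>\<^bsub>F\<^esub> f2) \<sqinter>\<^bsub>F\<^esub> \<tau> (h1 \<leadsto>\<^bsub>H\<^esub> h2)"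
proof -
  have "f \<sqsubseteq>\<^bsub>F\<^esub> \<tau> (h1 \<leadsto>\<^bsub>H\<^esub> h2)" if "h \<sqsubseteq>\<^bsub>H\<^esub> h1 \<leadsto>\<^bsub>H\<^esub> h2"
    using that assms by (meson F.le_trans H.himp_closed tau_mono tau_closed)
  then show ?thesis
    using assms by (auto simp: F.le_meet_iff F.himp_closed H.himp_closed tau_closed
        F.residuation H.residuation)
qed

text \<open>The order is an equation between meets, and meets of the gluing are componentwise, so
  this holds for all pairs, inside the carrier or not.\<close>

lemma le_gluing_iff:
  "(h1, f1) \<sqsubseteq>\<^bsub>artin_gluing H F \<tau>\<^esub> (h2, f2) \<longleftrightarrow> h1 \<sqsubseteq>\<^bsub>H\<^esub> h2 \<and> f1 \<sqsubseteq>\<^bsub>F\<^esub> f2"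
  by (auto simp: le_def artin_gluing_def)

text \<open>The goals follow the axioms: closure (1 to 5), lattice equations (6 to 11), bounds (12,
  13), residuation (14). Equations and bounds are inherited componentwise; \<open>\<tau>\<close>
  matters for closure and residuation.\<close>

lemma heyting_algebra_gluing: "heyting_algebra (artin_gluing H F \<tau>)"
proof (unfold_locales, goal_cases)
  case (1 x y)
  then show ?case
    by (auto simp: artin_gluing_def H.meet_closed F.meet_closed meet_preserving tau_closed
        intro!: F.meet_mono)
next
  case (2 x y)
  then show ?case
    by (auto simp: artin_gluing_def H.join_closed F.join_closed intro: gluing_join_below)
next
  case (3 x y)
  then show ?case
    by (auto simp: artin_gluing_def H.himp_closed F.himp_closed F.meet_closed F.meet_le2 tau_closed)
next
  case 4
  then show ?case
    by (auto simp: artin_gluing_def H.hbot_closed F.hbot_closed F.hbot_least tau_closed)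
next
  \<comment> \<open>The top pair belongs to the gluing only if the top of \<open>F\<close> lies
    below \<open>\<tau>\<close> of the top of \<open>H\<close>.\<close>
  case 5
  then show ?case
    by (auto simp: artin_gluing_def H.htop_closed F.htop_closed F.htop_greatest top_preserving)
next
  case (6 x y)
  then show ?case by (auto simp: artin_gluing_def intro: H.meet_commute F.meet_commute)
next
  case (7 x y)
  then show ?case by (auto simp: artin_gluing_def intro: H.join_commute F.join_commute)
next
  case (8 x y z)
  then show ?case by (auto simp: artin_gluing_def intro: H.meet_assoc F.meet_assoc)
next
  case (9 x y z)
  then show ?case by (auto simp: artin_gluing_def intro: H.join_assoc F.join_assoc)
next
  case (10 x y)
  then show ?case by (auto simp: artin_gluing_def intro: H.meet_join_absorb F.meet_join_absorb)
next
  case (11 x y)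
  then show ?case by (auto simp: artin_gluing_def intro: H.join_meet_absorb F.join_meet_absorb)
next
  case (12 x)
  then show ?case
    by (cases x) (auto simp: artin_gluing_def le_def H.hbot_least[unfolded le_def]
        F.hbot_least[unfolded le_def])
next
  case (13 x)
  then show ?case
    by (cases x) (auto simp: artin_gluing_def le_def H.htop_greatest[unfolded le_def]
        F.htop_greatest[unfolded le_def])
next
  case (14 x y z)
  obtain h1 f1 h2 f2 h f where [simp]: "x = (h1, f1)" "y = (h2, f2)" "z = (h, f)"
    by (metis surj_pair)
  have "z \<sqinter>\<^bsub>artin_gluing H F \<tau>\<^esub> x = (h \<sqinter>\<^bsub>H\<^esub> h1, f \<sqinter>\<^bsub>F\<^esub> f1)"
    and "x \<leadsto>\<^bsub>artin_gluing H F \<tau>\<^esub> y =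
      (h1 \<leadsto>\<^bsub>H\<^esub> h2, (f1 \<leadsto>\<^bsub>F\<^esub> f2) \<sqinter>\<^bsub>F\<^esub> \<tau> (h1 \<leadsto>\<^bsub>H\<^esub> h2))"
    by (simp_all add: artin_gluing_def)
  moreover have "h \<in> carrier H" "h1 \<in> carrier H" "h2 \<in> carrier H"
    "f \<in> carrier F" "f1 \<in> carrier F" "f2 \<in> carrier F" "f \<sqsubseteq>\<^bsub>F\<^esub> \<tau> h"
    using 14 by (auto simp: artin_gluing_def)
  ultimately show ?case
    using gluing_residuation[of h h1 h2 f f1 f2] by (simp only: \<open>y = _\<close> \<open>z = _\<close> le_gluing_iff)
qed

end

section \<open>Transport along concatenation\<close>

text \<open>Every point of \<open>B\<close> is some \<open>p a\<close> and \<open>q\<close> recovers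
  \<open>a\<close>, so each axiom pulls back to \<open>A\<close>. The operations of \<open>B\<close>
  are given on all arguments, in the form in which \<open>concat_heyting\<close> defines
  them.\<close>

lemma (in heyting_algebra) heyting_algebra_transport:
  assumes inv: "\<And>x. x \<in> carrier A \<Longrightarrow> q (p x) = x"
    and B: "carrier B = p ` carrier A"
      "\<And>u v. u \<sqinter>\<^bsub>B\<^esub> v = p (q u \<sqinter> q v)"
      "\<And>u v. u \<squnion>\<^bsub>B\<^esub> v = p (q u \<squnion> q v)"
      "\<And>u v. u \<leadsto>\<^bsub>B\<^esub> v = p (q u \<leadsto> q v)"
      "\<bottom>\<^bsub>B\<^esub> = p \<bottom>" "\<top>\<^bsub>B\<^esub> = p \<top>"
  shows "heyting_algebra B"
proof -
  have p_eq: "p x = p y \<longleftrightarrow> x = y" if "x \<in> carrier A" "y \<in> carrier A" for x y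
    using inv that by metis
  have le_B: "p x \<sqsubseteq>\<^bsub>B\<^esub> p y \<longleftrightarrow> x \<sqsubseteq> y" if "x \<in> carrier A" "y \<in> carrier A" for x y
    using that by (simp add: le_def B inv p_eq meet_closed)
  note closed = meet_closed join_closed himp_closed hbot_closed htop_closed
  show ?thesis
  proof (unfold_locales, goal_cases)
    case (6 x y) then show ?case by (auto simp: B inv meet_commute)
  next
    case (7 x y) then show ?case by (auto simp: B inv join_commute)
  next
    case (12 x) then show ?case by (auto simp: B(1,5) le_B closed hbot_least)
  next
    case (13 x) then show ?case by (auto simp: B(1,6) le_B closed htop_greatest)
  next
    case (14 x y z)
    then obtain a b c where "x = p a" "y = p b" "z = p c"
      and "a \<in> carrier A" "b \<in> carrier A" "c \<in> carrier A"
      by (auto simp: B)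
    then show ?case by (simp add: B(2,4) inv le_B closed residuation)
  qed (auto simp: B inv closed meet_assoc join_assoc meet_join_absorb join_meet_absorb)
qed

text \<open>A fixed length of the first components makes splitting at \<open>n\<close> a left
  inverse of concatenation.\<close>

lemma heyting_algebra_concat:
  assumes "heyting_algebra A" and "\<And>x. x \<in> carrier A \<Longrightarrow> length (fst x) = n"
  shows "heyting_algebra (concat_heyting n A)"
  by (rule heyting_algebra.heyting_algebra_transport[OF assms(1),
        where p = "\<lambda>(x, y). x @ y" and q = "\<lambda>u. (take n u, drop n u)"])
    (use assms(2) in \<open>auto simp: concat_heyting_def Let_def\<close>)

lemma carrier_concat: "carrier (concat_heyting n A) = {x @ y | x y. (x, y) \<in> carrier A}"
  by (auto simp: concat_heyting_def Let_def image_def split: prod.splits)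

lemma le_concat_iff:
  assumes "heyting_algebra A" and len: "\<And>x. x \<in> carrier A \<Longrightarrow> length (fst x) = n"
    and "(x, y) \<in> carrier A" "(x', y') \<in> carrier A"
  shows "x @ y \<sqsubseteq>\<^bsub>concat_heyting n A\<^esub> x' @ y' \<longleftrightarrow> (x, y) \<sqsubseteq>\<^bsub>A\<^esub> (x', y')"
proof -
  obtain a b where ab: "(x, y) \<sqinter>\<^bsub>A\<^esub> (x', y') = (a, b)" by (metis surj_pair)
  \<comment> \<open>Closure under meets fixes the length of \<open>a\<close>; only then does
    \<open>a @ b = x @ y\<close> split into two equations.\<close>
  then have "(a, b) \<in> carrier A" using assms by (metis heyting_algebra.meet_closed)
  then have "length a = n" "length x = n" "length x' = n" using len assms(3,4) by fastforce+
  then show ?thesis using ab by (simp add: le_def concat_heyting_def Let_def)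
qed

section \<open>Closure properties of definable sets\<close>

primrec rename_term :: "(nat \<Rightarrow> nat) \<Rightarrow> 'f fo_term \<Rightarrow> 'f fo_term" where
  "rename_term \<rho> (Var i) = Var (\<rho> i)"
| "rename_term \<rho> Zero = Zero"
| "rename_term \<rho> One = One"
| "rename_term \<rho> (Plus s t) = Plus (rename_term \<rho> s) (rename_term \<rho> t)"
| "rename_term \<rho> (Minus t) = Minus (rename_term \<rho> t)"
| "rename_term \<rho> (Times s t) = Times (rename_term \<rho> s) (rename_term \<rho> t)"
| "rename_term \<rho> (App f ts) = App f (map (rename_term \<rho>) ts)"

text \<open>Under \<open>Exists\<close> the map is lifted past the binder: index 0 stays bound and
  \<open>Suc i\<close> goes to \<open>Suc (\<rho> i)\<close>.\<close>

primrec rename :: "(nat \<Rightarrow> nat) \<Rightarrow> ('f, 'p) formula \<Rightarrow> ('f, 'p) formula" where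
  "rename \<rho> (Equal s t) = Equal (rename_term \<rho> s) (rename_term \<rho> t)"
| "rename \<rho> (Less s t) = Less (rename_term \<rho> s) (rename_term \<rho> t)"
| "rename \<rho> (Rel p ts) = Rel p (map (rename_term \<rho>) ts)"
| "rename \<rho> (Neg \<phi>) = Neg (rename \<rho> \<phi>)"
| "rename \<rho> (Conj \<phi> \<psi>) = Conj (rename \<rho> \<phi>) (rename \<rho> \<psi>)"
| "rename \<rho> (Exists \<phi>) = Exists (rename (case_nat 0 (Suc \<circ> \<rho>)) \<phi>)"

lemma wf_rename_term [simp]: "wf_term M (rename_term \<rho> t) = wf_term M t"
  by (induction t) auto

lemma wf_rename [simp]: "wf_formula M (rename \<rho> \<phi>) = wf_formula M \<phi>"
  by (induction \<phi> arbitrary: \<rho>) auto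

lemma eval_rename_term [simp]: "eval_term M e (rename_term \<rho> t) = eval_term M (e \<circ> \<rho>) t"
  by (induction t) (auto simp: comp_def cong: map_cong)

lemma sat_rename: "sat M e (rename \<rho> \<phi>) = sat M (e \<circ> \<rho>) \<phi>"
proof (induction \<phi> arbitrary: \<rho> e)
  case (Rel p ts)
  have "map (eval_term M e \<circ> rename_term \<rho>) ts = map (eval_term M (e \<circ> \<rho>)) ts"
    by (simp add: comp_def)
  then show ?case by (simp only: rename.simps sat.simps map_map)
next
  case (Exists \<phi>)
  \<comment> \<open>Lifting the renaming commutes with pushing a value onto the environment.\<close>
  have "case_nat x e \<circ> case_nat 0 (Suc \<circ> \<rho>) = case_nat x (e \<circ> \<rho>)" for x
    by (auto simp: fun_eq_iff split: nat.splits)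
  then show ?case by (simp only: rename.simps sat.simps Exists.IH)
qed auto

section \<open>Coordinate preimages, intersections and projections of definable sets\<close>

lemma definableI:
  "wf_formula M \<phi> \<Longrightarrow>
    definable M n {xs. length xs = n \<and> sat M (\<lambda>i. if i < n then xs ! i else e i) \<phi>}"
  unfolding definable_def by (rule exI, rule exI, rule conjI, assumption, rule refl)

lemma definable_length: "\<lbrakk>definable M n X; xs \<in> X\<rbrakk> \<Longrightarrow> length xs = n"
  by (auto simp: definable_def)

text \<open>The map \<open>g\<close> only selects coordinates, so its preimage is obtained by
  renaming the variables of the defining formula along \<open>\<sigma>\<close>.\<close>

lemma definable_reindex:
  fixes M :: "('f, 'p, 'r::linordered_field) expansion"
  assumes "definable M k X"
    and \<sigma>: "\<And>i. i < k \<Longrightarrow> \<sigma> i < n"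
    and g: "\<And>xs. length xs = n \<Longrightarrow> length (g xs) = k"
      "\<And>xs i. \<lbrakk>length xs = n; i < k\<rbrakk> \<Longrightarrow> g xs ! i = xs ! \<sigma> i"
  shows "definable M n {xs. length xs = n \<and> g xs \<in> X}"
proof -
  obtain \<phi> e where \<phi>: "wf_formula M \<phi>"
    "X = {xs. length xs = k \<and> sat M (\<lambda>i. if i < k then xs ! i else e i) \<phi>}"
    using assms(1) by (auto simp: definable_def)
  \<comment> \<open>Parameters start at index \<open>k\<close> for \<open>X\<close> but at
    \<open>n\<close> for the preimage; \<open>\<rho>\<close> moves them and \<open>e'\<close> shifts
    their values to match.\<close>
  define \<rho> where "\<rho> = (\<lambda>i. if i < k then \<sigma> i else n + (i - k))"
  define e' where "e' = (\<lambda>i. e (i - n + k))"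
  have env: "(\<lambda>i. if i < n then xs ! i else e' i) \<circ> \<rho> = (\<lambda>i. if i < k then g xs ! i else e i)"
    if "length xs = n" for xs
  proof
    show "((\<lambda>i. if i < n then xs ! i else e' i) \<circ> \<rho>) i = (if i < k then g xs ! i else e i)" for i
    proof (cases "i < k")
      case False
      then have "\<not> n + (i - k) < n" "n + (i - k) - n + k = i" by linarith+
      then show ?thesis using False by (simp only: comp_apply \<rho>_def e'_def if_False)
    qed (simp add: \<rho>_def \<sigma> g(2)[OF that])
  qed
  have "{xs. length xs = n \<and> g xs \<in> X} =
      {xs. length xs = n \<and> sat M (\<lambda>i. if i < n then xs ! i else e' i) (rename \<rho> \<phi>)}"
  proof (intro Collect_cong conj_cong refl)
    fix xs :: "'r list" assume len: "length xs = n"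
    show "g xs \<in> X \<longleftrightarrow> sat M (\<lambda>i. if i < n then xs ! i else e' i) (rename \<rho> \<phi>)"
      unfolding sat_rename env[OF len] \<phi>(2) using g(1)[OF len] by simp
  qed
  then show ?thesis
    using \<phi>(1) by (simp only: definableI wf_rename)
qed

text \<open>
  The two parameter lists are interleaved, so that both formulas can be evaluated in one
  environment.
\<close>

lemma definable_Int:
  assumes "definable M n X" "definable M n Y"
  shows "definable M n (X \<inter> Y)"
proof -
  obtain \<phi> d where \<phi>: "wf_formula M \<phi>"
    "X = {xs. length xs = n \<and> sat M (\<lambda>i. if i < n then xs ! i else d i) \<phi>}"
    using assms(1) by (auto simp: definable_def)
  obtain \<psi> e where \<psi>: "wf_formula M \<psi>"
    "Y = {xs. length xs = n \<and> sat M (\<lambda>i. if i < n then xs ! i else e i) \<psi>}"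
    using assms(2) by (auto simp: definable_def)
  define \<rho> where "\<rho> = (\<lambda>i. if i < n then i else n + 2 * (i - n))"
  define \<rho>' where "\<rho>' = (\<lambda>i. if i < n then i else Suc (n + 2 * (i - n)))"
  define c where "c = (\<lambda>i. if even (i - n) then d (n + (i - n) div 2) else e (n + (i - n) div 2))"
  define env where "env = (\<lambda>xs i. if i < n then xs ! i else c i)"
  have "env xs \<circ> \<rho> = (\<lambda>i. if i < n then xs ! i else d i)"
    "env xs \<circ> \<rho>' = (\<lambda>i. if i < n then xs ! i else e i)" for xs
    by (auto simp: env_def \<rho>_def \<rho>'_def c_def fun_eq_iff Suc_diff_le)
  then have "X \<inter> Y = {xs. length xs = n \<and> sat M (env xs) (Conj (rename \<rho> \<phi>) (rename \<rho>' \<psi>))}"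
    by (auto simp: sat_rename \<phi>(2) \<psi>(2))
  moreover have "wf_formula M (Conj (rename \<rho> \<phi>) (rename \<rho>' \<psi>))"
    using \<phi>(1) \<psi>(1) by simp
  ultimately show ?thesis
    unfolding env_def by (simp only: definableI)
qed

text \<open>\<open>Exists\<close> binds index 0, the head of the list, so the first coordinate is
  the one projected away. The remaining indices drop by one, hence the parameters
  \<open>e (Suc i)\<close>.\<close>

lemma definable_Exists:
  assumes "definable M (Suc n) X"
  shows "definable M n {xs. \<exists>y. y # xs \<in> X}"
proof -
  obtain \<phi> e where \<phi>: "wf_formula M \<phi>"
    "X = {xs. length xs = Suc n \<and> sat M (\<lambda>i. if i < Suc n then xs ! i else e i) \<phi>}"
    using assms by (auto simp: definable_def)
  have "case_nat y (\<lambda>i. if i < n then xs ! i else e (Suc i)) =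
      (\<lambda>i. if i < Suc n then (y # xs) ! i else e i)" for xs y
    by (auto simp: fun_eq_iff split: nat.splits)
  then have "{xs. \<exists>y. y # xs \<in> X} =
      {xs. length xs = n \<and> sat M (\<lambda>i. if i < n then xs ! i else e (Suc i)) (Exists \<phi>)}"
    by (auto simp: \<phi>(2))
  moreover have "wf_formula M (Exists \<phi>)"
    using \<phi>(1) by simp
  ultimately show ?thesis
    by (simp only: definableI)
qed

lemma definable_projection:
  "definable M (m + n) X \<Longrightarrow> definable M n {xs. \<exists>ys. length ys = m \<and> ys @ xs \<in> X}"
proof (induction m arbitrary: X)
  case (Suc m)
  \<comment> \<open>The head of \<open>ys\<close> is projected out first; the induction hypothesis
    removes the tail.\<close>
  have "{xs. \<exists>ys. length ys = Suc m \<and> ys @ xs \<in> X} =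
      {xs. \<exists>ys. length ys = m \<and> ys @ xs \<in> {zs. \<exists>y. y # zs \<in> X}}"
    by (simp add: set_eq_iff length_Suc_conv) (metis append_Cons)
  then show ?case
    using Suc.IH[OF definable_Exists] Suc.prems by simp
qed simp

section \<open>Definability of the gluing\<close>

text \<open>With the length of the first part fixed, a concatenation splits in one way only. Used
  for the two order relations and for the graph of \<open>\<tau>\<close>.\<close>

lemma append_mem_iff:
  assumes "\<And>x. x \<in> X \<Longrightarrow> length x = n" and "length x = n"
  shows "x @ y \<in> {x @ y | x y. x \<in> X \<and> P x y} \<longleftrightarrow> x \<in> X \<and> P x y"
proof
  assume "x @ y \<in> {x @ y | x y. x \<in> X \<and> P x y}"
  then obtain a b where ab: "x @ y = a @ b" "a \<in> X" "P a b" by blast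
  then have "length x = length a" using assms by simp
  then show "x \<in> X \<and> P x y" using ab by simp
qed blast

context
  fixes M :: "('f, 'p, 'r::linordered_field) expansion" and n m :: nat
    and H F :: "'r list heyting" and \<tau> :: "'r list \<Rightarrow> 'r list"
  assumes data: "gluing_data H F \<tau>"
    and def_H: "definable_heyting M n H" and def_F: "definable_heyting M m F"
    and def_tau: "definable_map M n m (carrier H) \<tau>"
begin

interpretation gluing_data H F \<tau> by (rule data)

lemma length_H: "h \<in> carrier H \<Longrightarrow> length h = n"
  using def_H definable_length by (auto simp: definable_heyting_def)

lemma length_F: "f \<in> carrier F \<Longrightarrow> length f = m"
  using def_F definable_length by (auto simp: definable_heyting_def)

lemma append_mem_le_H:
  "length x = n \<Longrightarrow> x @ y \<in> {x @ y | x y. x \<in> carrier H \<and> y \<in> carrier H \<and> x \<sqsubseteq>\<^bsub>H\<^esub> y}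
    \<longleftrightarrow> x \<in> carrier H \<and> y \<in> carrier H \<and> x \<sqsubseteq>\<^bsub>H\<^esub> y"
  by (rule append_mem_iff[OF length_H])

lemma append_mem_le_F:
  "length x = m \<Longrightarrow> x @ y \<in> {x @ y | x y. x \<in> carrier F \<and> y \<in> carrier F \<and> x \<sqsubseteq>\<^bsub>F\<^esub> y}
    \<longleftrightarrow> x \<in> carrier F \<and> y \<in> carrier F \<and> x \<sqsubseteq>\<^bsub>F\<^esub> y"
  by (rule append_mem_iff[OF length_F])

lemma append_mem_graph:
  assumes "length x = n"
  shows "x @ y \<in> {x @ \<tau> x | x. x \<in> carrier H} \<longleftrightarrow> x \<in> carrier H \<and> y = \<tau> x"
proof -
  have "{x @ \<tau> x | x. x \<in> carrier H} = {x @ y | x y. x \<in> carrier H \<and> y = \<tau> x}"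
    by blast
  then show ?thesis by (simp only: append_mem_iff[OF length_H assms])
qed

lemma definable_carrier:
  "definable M (n + m) (carrier (concat_heyting n (artin_gluing H F \<tau>)))"
proof -
  let ?G = "{x @ \<tau> x | x. x \<in> carrier H}"
  let ?L = "{x @ y | x y. x \<in> carrier F \<and> y \<in> carrier F \<and> x \<sqsubseteq>\<^bsub>F\<^esub> y}"
  \<comment> \<open>Points \<open>ws\<close> are read as \<open>y @ h @ f\<close>, with the
    auxiliary \<open>y\<close> in front because \<open>definable_projection\<close> removes a
    prefix.\<close>
  let ?graph = "{ws. length ws = m + (n + m) \<and> take n (drop m ws) @ take m ws \<in> ?G}"
  let ?below = "{ws. length ws = m + (n + m) \<and> drop (m + n) ws @ take m ws \<in> ?L}"
  have "definable M (n + m) ?G"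
    using def_tau by (simp add: definable_map_def)
  then have graph: "definable M (m + (n + m)) ?graph"
    \<comment> \<open>In \<open>ws\<close> the block \<open>h\<close> begins at \<open>m\<close> and
      \<open>y\<close> at 0.\<close>
    by (rule definable_reindex[where \<sigma> = "\<lambda>i. if i < n then m + i else i - n"])
      (auto simp: nth_append)
  have "definable M (m + m) ?L"
    using def_F by (simp add: definable_heyting_def)
  then have below: "definable M (m + (n + m)) ?below"
    \<comment> \<open>The block \<open>f\<close> begins at \<open>m + n\<close>.\<close>
    by (rule definable_reindex[where \<sigma> = "\<lambda>i. if i < m then m + n + i else i - m"])
      (auto simp: nth_append)
  from graph below have "definable M (n + m) {xs. \<exists>ys. length ys = m \<and> ys @ xs \<in> ?graph \<inter> ?below}"
    by (intro definable_projection definable_Int)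
  also have "{xs. \<exists>ys. length ys = m \<and> ys @ xs \<in> ?graph \<inter> ?below} =
      carrier (concat_heyting n (artin_gluing H F \<tau>))" (is "?lhs = ?rhs")
  proof (intro set_eqI iffI)
    fix xs assume "xs \<in> ?lhs"
    then obtain ys where ys: "length ys = m" "ys @ xs \<in> ?graph" "ys @ xs \<in> ?below"
      by blast
    then have len: "length xs = n + m"
      by simp
    have "take n xs @ ys \<in> ?G" "drop n xs @ ys \<in> ?L"
      using ys by simp_all
    then have "take n xs \<in> carrier H \<and> ys = \<tau> (take n xs)"
      "drop n xs \<in> carrier F \<and> ys \<in> carrier F \<and> drop n xs \<sqsubseteq>\<^bsub>F\<^esub> ys"
      using append_mem_graph[of "take n xs" ys] append_mem_le_F[of "drop n xs" ys] len
      by (simp_all only: length_take length_drop min_def) simp_all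
    then have "(take n xs, drop n xs) \<in> carrier (artin_gluing H F \<tau>)"
      by (simp add: artin_gluing_def)
    then have "take n xs @ drop n xs \<in> ?rhs"
      unfolding carrier_concat by blast
    then show "xs \<in> ?rhs" by simp
  next
    fix xs assume "xs \<in> ?rhs"
    then obtain h f where "xs = h @ f" "h \<in> carrier H" "f \<in> carrier F" "f \<sqsubseteq>\<^bsub>F\<^esub> \<tau> h"
      by (auto simp: carrier_concat artin_gluing_def)
    moreover from this have "length h = n" "length f = m" "length (\<tau> h) = m"
      using length_H length_F tau_closed by blast+
    \<comment> \<open>The witness for the projected block is \<open>\<tau> h\<close> itself.\<close>
    ultimately have "\<tau> h @ xs \<in> ?graph \<inter> ?below"
      using tau_closed by auto
    then show "xs \<in> ?lhs"
      using \<open>length (\<tau> h) = m\<close> by blast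
  qed
  finally show ?thesis .
qed

text \<open>The order is cut out by four conditions: two place the halves in the carrier, two
  compare their components in \<open>H\<close> and in \<open>F\<close>.\<close>

lemma definable_order:
  fixes A defines "A \<equiv> concat_heyting n (artin_gluing H F \<tau>)"
  shows "definable M ((n + m) + (n + m))
    {x @ y | x y. x \<in> carrier A \<and> y \<in> carrier A \<and> x \<sqsubseteq>\<^bsub>A\<^esub> y}"
proof -
  let ?N = "(n + m) + (n + m)"
  let ?LH = "{x @ y | x y. x \<in> carrier H \<and> y \<in> carrier H \<and> x \<sqsubseteq>\<^bsub>H\<^esub> y}"
  let ?LF = "{x @ y | x y. x \<in> carrier F \<and> y \<in> carrier F \<and> x \<sqsubseteq>\<^bsub>F\<^esub> y}"
  let ?S1 = "{ws. length ws = ?N \<and> take (n + m) ws \<in> carrier A}"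
  let ?S2 = "{ws. length ws = ?N \<and> drop (n + m) ws \<in> carrier A}"
  \<comment> \<open>Points are read as \<open>h @ f @ h' @ f'\<close>, with blocks starting at 0,
    \<open>n\<close>, \<open>n + m\<close> and \<open>n + m + n\<close>.\<close>
  let ?S3 = "{ws. length ws = ?N \<and> take n ws @ take n (drop (n + m) ws) \<in> ?LH}"
  let ?S4 = "{ws. length ws = ?N \<and> take m (drop n ws) @ drop (n + m + n) ws \<in> ?LF}"
  have def_A: "definable M (n + m) (carrier A)"
    unfolding A_def by (rule definable_carrier)
  have "definable M ?N ?S1"
    using def_A by (rule definable_reindex[where \<sigma> = "\<lambda>i. i"]) auto
  moreover have "definable M ?N ?S2"
    using def_A by (rule definable_reindex[where \<sigma> = "\<lambda>i. n + m + i"]) auto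
  moreover have "definable M (n + n) ?LH"
    using def_H by (simp add: definable_heyting_def)
  then have "definable M ?N ?S3"
    \<comment> \<open>Position \<open>i \<ge> n\<close> is entry \<open>i - n\<close> of
      \<open>h'\<close>, at \<open>n + m + (i - n) = m + i\<close>.\<close>
    by (rule definable_reindex[where \<sigma> = "\<lambda>i. if i < n then i else m + i"])
      (auto simp: nth_append intro!: arg_cong[where f = "nth _"])
  moreover have "definable M (m + m) ?LF"
    using def_F by (simp add: definable_heyting_def)
  then have "definable M ?N ?S4"
    \<comment> \<open>Position \<open>i \<ge> m\<close> is entry \<open>i - m\<close> of
      \<open>f'\<close>, at \<open>n + m + n + (i - m) = n + n + i\<close>.\<close>
    by (rule definable_reindex[where \<sigma> = "\<lambda>i. if i < m then n + i else n + n + i"])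
      (auto simp: nth_append intro!: arg_cong[where f = "nth _"])
  ultimately have "definable M ?N ((?S1 \<inter> ?S2) \<inter> (?S3 \<inter> ?S4))"
    by (intro definable_Int)
  also have "(?S1 \<inter> ?S2) \<inter> (?S3 \<inter> ?S4) =
      {x @ y | x y. x \<in> carrier A \<and> y \<in> carrier A \<and> x \<sqsubseteq>\<^bsub>A\<^esub> y}" (is "?lhs = ?rhs")
  proof -
    have carrier_A: "u \<in> carrier A \<Longrightarrow> \<exists>h f. u = h @ f \<and> (h, f) \<in> carrier (artin_gluing H F \<tau>)
        \<and> h \<in> carrier H \<and> f \<in> carrier F \<and> length h = n \<and> length f = m" for u
      unfolding A_def carrier_concat using length_H length_F by (auto simp: artin_gluing_def)
    have le_A: "h @ f \<sqsubseteq>\<^bsub>A\<^esub> h' @ f' \<longleftrightarrow> h \<sqsubseteq>\<^bsub>H\<^esub> h' \<and> f \<sqsubseteq>\<^bsub>F\<^esub> f'"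
      if "(h, f) \<in> carrier (artin_gluing H F \<tau>)" "(h', f') \<in> carrier (artin_gluing H F \<tau>)"
      for h f h' f'
      unfolding A_def le_gluing_iff[symmetric]
      by (rule le_concat_iff[OF heyting_algebra_gluing _ that])
        (auto simp: artin_gluing_def length_H)
    \<comment> \<open>Once \<open>?S1\<close> and \<open>?S2\<close> provide carrier membership, the
      other two conditions express exactly the order.\<close>
    have mem: "u @ v \<in> ?S3 \<inter> ?S4 \<longleftrightarrow> u \<sqsubseteq>\<^bsub>A\<^esub> v" if uv: "u \<in> carrier A" "v \<in> carrier A" for u v
    proof -
      obtain h f h' f' where
        u: "u = h @ f" "(h, f) \<in> carrier (artin_gluing H F \<tau>)" "h \<in> carrier H" "f \<in> carrier F"
          "length h = n" "length f = m" and
        v: "v = h' @ f'" "(h', f') \<in> carrier (artin_gluing H F \<tau>)" "h' \<in> carrier H" "f' \<in> carrier F"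
          "length h' = n" "length f' = m"
        using carrier_A uv by metis
      have "take n (u @ v) @ take n (drop (n + m) (u @ v)) = h @ h'"
        "take m (drop n (u @ v)) @ drop (n + m + n) (u @ v) = f @ f'" "length (u @ v) = ?N"
        using u v by simp_all
      then have "u @ v \<in> ?S3 \<inter> ?S4 \<longleftrightarrow> h @ h' \<in> ?LH \<and> f @ f' \<in> ?LF"
        by (simp only: Int_iff mem_Collect_eq simp_thms)
      also have "\<dots> \<longleftrightarrow> h \<sqsubseteq>\<^bsub>H\<^esub> h' \<and> f \<sqsubseteq>\<^bsub>F\<^esub> f'"
        unfolding append_mem_le_H[OF u(5)] append_mem_le_F[OF u(6)] using u v by blast
      also have "\<dots> \<longleftrightarrow> u \<sqsubseteq>\<^bsub>A\<^esub> v"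
        unfolding u(1) v(1) le_A[OF u(2) v(2)] ..
      finally show ?thesis .
    qed
    have len_A: "length u = n + m" if "u \<in> carrier A" for u
      using carrier_A[OF that] by auto
    show ?thesis
    proof (intro set_eqI iffI)
      fix ws assume ws: "ws \<in> ?lhs"
      let ?u = "take (n + m) ws" and ?v = "drop (n + m) ws"
      have "?u \<in> carrier A" "?v \<in> carrier A"
        using ws by blast+
      moreover have "?u @ ?v \<in> ?S3 \<inter> ?S4"
        unfolding append_take_drop_id using ws by blast
      ultimately have "?u @ ?v \<in> ?rhs" using mem by blast
      then show "ws \<in> ?rhs" by (simp only: append_take_drop_id)
    next
      fix ws assume "ws \<in> ?rhs"
      then obtain u v where uv: "ws = u @ v" "u \<in> carrier A" "v \<in> carrier A" "u \<sqsubseteq>\<^bsub>A\<^esub> v"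
        by blast
      then have "ws \<in> ?S3 \<inter> ?S4" using mem by blast
      moreover have "ws \<in> ?S1 \<inter> ?S2" using uv len_A by simp
      ultimately show "ws \<in> ?lhs" by blast
    qed
  qed
  finally show ?thesis .
qed

lemma definable_heyting_gluing:
  "definable_heyting M (n + m) (concat_heyting n (artin_gluing H F \<tau>))"
  unfolding definable_heyting_def
  by (intro conjI heyting_algebra_concat heyting_algebra_gluing definable_carrier definable_order)
    (auto simp: artin_gluing_def length_H)

end

theorem proposition2p4:
  shows "(\<forall>(H :: 'a heyting) (F :: 'b heyting) \<tau>.
            gluing_data H F \<tau> \<longrightarrow> heyting_algebra (artin_gluing H F \<tau>))
       \<and> (\<forall>(M :: ('f, 'p, 'r::real_closed_field) expansion) n m H F \<tau>.
            o_minimal M \<longrightarrow> gluing_data H F \<tau> \<longrightarrow>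
            definable_heyting M n H \<longrightarrow> definable_heyting M m F \<longrightarrow>
            definable_map M n m (carrier H) \<tau> \<longrightarrow>
            definable_heyting M (n + m) (concat_heyting n (artin_gluing H F \<tau>)))"
  by (intro conjI allI impI gluing_data.heyting_algebra_gluing definable_heyting_gluing)

end
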